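(* Let $r,t\in\mathbb{N}$. There are constants $\alpha=\alpha(r,t)>0$ and $N_0=N_0(r,t)$ such that the following two assertions hold. (1) For every $N\ge N_0$ and every finite cyclic group $G$ of order $N$, written additively, there exists a partition $G=\bigcup_{i=1}^r E_i$ such that for every finite coloring of $G$ with $t$ colors, $G=\bigcup_{j=1}^t F_j$, there exist a single color class $F_m$, $1\le m\le t$, and an element $h\in G$ such that \[ \forall\, i\in\{1,2,\ldots,r\},\quad |(F_m+h)\cap E_i|\ge \alpha|G|. \] (2) The same conclusion holds for any finite abelian group $G$ (written additively) whose exponent is at least $N_0$, with $\alpha$ replaced by a constant $\alpha'(r,t)\ge \frac{\alpha(r,t)}{t}$: there exists a partition $G=\bigcup_{i=1}^r E_i$ such that for every coloring $G=\bigcup_{j=1}^t F_j$ with $t$ colors there exist $m\in\{1,\dots,t\}$ and $h\in G$ such that $|(F_m+h)\cap E_i|\ge \alpha'(r,t)|G|$ for all $i\in\{1,\dots,r\}$.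
   Context: $\mathbb{N}$ is the set of positive integers. A coloring of $G$ with $t$ colors is a partition of $G$ into $t$ pairwise disjoint sets $F_1,\dots,F_t$ (the color classes). $F+h=\{g+h:g\in F\}$. The constants depend only on $r$ and $t$. *)

theory Defs
  imports Complex_Main "HOL-Library.Disjoint_Sets" "HOL-Algebra.Algebra"
begin

text \<open>
  Finite abelian groups are written additively: \<open>G\<close> is a record with \<open>abelian_group G\<close>,
  which constrains only the additive part; the fields \<open>mult\<close> and \<open>one\<close> play no role.
  The translate \<open>F + h\<close> is the library's \<open>F +>\<^bsub>G\<^esub> h\<close>.
\<close>

text \<open>
  Partitions and colorings are families of pairwise disjoint sets indexed by \<open>1, \<dots>, n\<close>, so a
  class may be empty (a coloring need not use all its colors).
\<close>

definition indexed_partition :: "'a set \<Rightarrow> nat \<Rightarrow> (nat \<Rightarrow> 'a set) \<Rightarrow> bool" where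
  "indexed_partition A n E \<longleftrightarrow>
     (\<Union>i\<in>{1..n}. E i) = A \<and> disjoint_family_on E {1..n}"

text \<open>Every finite group has a positive annihilating multiple, so there the \<open>LEAST\<close> is attained.\<close>

definition group_exponent :: "'a ring \<Rightarrow> nat" where
  "group_exponent G =
     (LEAST n. n > 0 \<and> (\<forall>x\<in>carrier G. [n] \<cdot>\<^bsub>G\<^esub> x = \<zero>\<^bsub>G\<^esub>))"

definition has_unavoidable_partition :: "nat \<Rightarrow> nat \<Rightarrow> real \<Rightarrow> 'a ring \<Rightarrow> bool" where
  "has_unavoidable_partition r t c G \<longleftrightarrow>
     (\<exists>E. indexed_partition (carrier G) r E \<and>
       (\<forall>F. indexed_partition (carrier G) t F \<longrightarrow>
         (\<exists>m\<in>{1..t}. \<exists>h\<in>carrier G. \<forall>i\<in>{1..r}.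
            real (card ((F m +>\<^bsub>G\<^esub> h) \<inter> E i)) \<ge> c * real (order G))))"

text \<open>
  The two assertions, for groups whose elements are taken from the type \<open>'a\<close>.
\<close>

definition cyclic_assertion :: "'a itself \<Rightarrow> nat \<Rightarrow> nat \<Rightarrow> real \<Rightarrow> nat \<Rightarrow> bool" where
  "cyclic_assertion _ r t \<alpha> N0 \<longleftrightarrow>
     (\<forall>N\<ge>N0. \<forall>G :: 'a ring.
        abelian_group G \<and> finite (carrier G) \<and> cyclic_group (add_monoid G) \<and> order G = N \<longrightarrow>
        has_unavoidable_partition r t \<alpha> G)"

definition abelian_assertion :: "'a itself \<Rightarrow> nat \<Rightarrow> nat \<Rightarrow> real \<Rightarrow> nat \<Rightarrow> bool" where
  "abelian_assertion _ r t \<alpha>' N0 \<longleftrightarrow>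
     (\<forall>G :: 'a ring.
        abelian_group G \<and> finite (carrier G) \<and> group_exponent G \<ge> N0 \<longrightarrow>
        has_unavoidable_partition r t \<alpha>' G)"

text \<open>
  The constants must be the same for all finite groups, whatever the type of their elements, but
  HOL has no quantifier over types to place after \<open>\<exists>\<alpha> N0 \<alpha>'\<close>. The theorem therefore has two
  conjuncts: constants exist for the groups with elements in \<open>nat\<close> (every finite group has an
  isomorphic copy there), and any constants valid for those groups are valid for the groups with
  elements in an arbitrary type \<open>'a\<close>. The first conjunct contains no type variable, so together
  they give one choice of constants, depending only on \<open>r\<close> and \<open>t\<close>, for all types at once.
\<close>

end

theory Submission
  imports Defs
begin

text \<open>
  Colour the elements of \<open>G\<close> independently and uniformly with \<open>r\<close> colours and let \<open>g\<^sub>i\<close> be the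
  indicator of the \<open>i\<close>-th class minus \<open>1/r\<close>. For \<open>d \<noteq> 0\<close> the autocorrelation
  \<open>A\<^sub>i(d) = \<Sum>\<^sub>x g\<^sub>i(x) g\<^sub>i(x + d)\<close> has second moment at most \<open>2|G|\<close>, so some colouring has
  \<open>\<Sum>\<^sub>d |A\<^sub>i(d)| = o(|G|\<^sup>2)\<close> for all \<open>i\<close>. For every \<open>F \<subseteq> G\<close> the sum over \<open>h\<close> of
  \<open>(|(F + h) \<inter> E\<^sub>i| - |F|/r)\<^sup>2\<close> equals \<open>\<Sum>\<^bsub>x,y\<in>F\<^esub> A\<^sub>i(y - x)\<close>, which is \<open>o(|G|\<^sup>3)\<close>. Hence as soon as
  \<open>|F| \<ge> |G|/t\<close>, which holds for the largest class of any \<open>t\<close>-colouring, some translate of \<open>F\<close> meets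
  every \<open>E\<^sub>i\<close> in about \<open>|F|/r\<close> elements.
  Both assertions are instances, since the exponent is at most \<open>|G|\<close>.
\<close>

section \<open>Independence of the values of a random colouring\<close>

text \<open>Splitting off the coordinate \<open>u\<close>, on which \<open>\<phi>\<close> does not
  depend, factors the sum into \<open>\<Sum>j\<in>B. w j\<close> and a sum over the other
  coordinates. In probabilistic terms, a mean-zero factor that is independent of the rest has
  expectation zero.\<close>

lemma sum_PiE_centered_coordinate:
  fixes w :: "'b \<Rightarrow> 'c::comm_semiring_0"
  assumes "finite A" "finite B" "u \<in> A" "(\<Sum>j\<in>B. w j) = 0"
    and indep: "\<And>c j. \<phi> (c(u := j)) = \<phi> c"
  shows "(\<Sum>c\<in>A \<rightarrow>\<^sub>E B. w (c u) * \<phi> c) = 0"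
proof -
  define A' where "A' = A - {u}"
  have A: "A = insert u A'" and u: "u \<notin> A'"
    using assms(3) by (auto simp: A'_def)
  have "(\<Sum>c\<in>A \<rightarrow>\<^sub>E B. w (c u) * \<phi> c)
      = (\<Sum>(j, c)\<in>B \<times> (A' \<rightarrow>\<^sub>E B). w ((c(u := j)) u) * \<phi> (c(u := j)))"
    unfolding A PiE_insert_eq
    by (subst sum.reindex[OF inj_combinator[OF u]]) (auto simp: case_prod_unfold)
  also have "\<dots> = (\<Sum>j\<in>B. w j) * (\<Sum>c\<in>A' \<rightarrow>\<^sub>E B. \<phi> c)"
    by (simp add: indep sum_product sum.cartesian_product)
  finally show ?thesis
    using assms(4) by simp
qed

section \<open>Autocorrelations and sums over translates\<close>

definition autocorrelation :: "('a, 'm) ring_scheme \<Rightarrow> ('a \<Rightarrow> real) \<Rightarrow> 'a \<Rightarrow> real" where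
  "autocorrelation G g d = (\<Sum>x\<in>carrier G. g x * g (x \<oplus>\<^bsub>G\<^esub> d))"

lemma (in abelian_group) bij_betw_add_left:
  assumes "a \<in> carrier G"
  shows "bij_betw (\<lambda>x. a \<oplus> x) (carrier G) (carrier G)"
proof (rule bij_betwI[where g = "\<lambda>x. \<ominus> a \<oplus> x"])
qed (use assms in \<open>auto simp: r_neg1 r_neg2\<close>)

text \<open>Since \<open>y \<oplus> h\<close> is \<open>x \<oplus> h\<close> plus
  \<open>y \<ominus> x\<close>, taking \<open>x \<oplus> h\<close> as the summation variable leaves
  only the difference of the two points.\<close>

lemma (in abelian_group) autocorrelation_shift:
  assumes "x \<in> carrier G" "y \<in> carrier G"
  shows "(\<Sum>h\<in>carrier G. g (x \<oplus> h) * g (y \<oplus> h)) = autocorrelation G g (y \<ominus> x)"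
proof -
  have "(\<Sum>h\<in>carrier G. g (x \<oplus> h) * g (y \<oplus> h))
      = (\<Sum>h\<in>carrier G. g (x \<oplus> h) * g ((x \<oplus> h) \<oplus> (y \<ominus> x)))"
  proof (rule sum.cong[OF refl])
    fix h assume h: "h \<in> carrier G"
    have "(x \<oplus> h) \<oplus> (y \<ominus> x) = y \<oplus> h \<oplus> (x \<oplus> \<ominus> x)"
      using assms h by (simp add: minus_eq a_ac del: r_neg)
    then show "g (x \<oplus> h) * g (y \<oplus> h) = g (x \<oplus> h) * g ((x \<oplus> h) \<oplus> (y \<ominus> x))"
      using assms h by (simp add: r_neg)
  qed
  also have "\<dots> = autocorrelation G g (y \<ominus> x)"
    unfolding autocorrelation_def
    by (rule sum.reindex_bij_betw[OF bij_betw_add_left[OF assms(1)]])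
  finally show ?thesis .
qed

text \<open>Expanding the square turns the left side into a double sum of autocorrelations at the
  differences \<open>y \<ominus> x\<close>. For fixed \<open>x\<close> these differences are
  distinct, so each inner sum is at most the full sum of absolute values. The bound depends on
  \<open>F\<close> only through its size, so one colouring can serve every \<open>F\<close>.\<close>

lemma (in abelian_group) sum_translates_square_le:
  assumes "finite (carrier G)" "F \<subseteq> carrier G"
  shows "(\<Sum>h\<in>carrier G. (\<Sum>x\<in>F. g (x \<oplus> h))\<^sup>2)
       \<le> real (card F) * (\<Sum>d\<in>carrier G. \<bar>autocorrelation G g d\<bar>)"
proof -
  have "(\<Sum>h\<in>carrier G. (\<Sum>x\<in>F. g (x \<oplus> h))\<^sup>2)
      = (\<Sum>h\<in>carrier G. \<Sum>x\<in>F. \<Sum>y\<in>F. g (x \<oplus> h) * g (y \<oplus> h))"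
    by (simp add: power2_eq_square sum_product)
  also have "\<dots> = (\<Sum>x\<in>F. \<Sum>y\<in>F. \<Sum>h\<in>carrier G. g (x \<oplus> h) * g (y \<oplus> h))"
    by (subst sum.swap, rule sum.cong[OF refl], rule sum.swap)
  also have "\<dots> = (\<Sum>x\<in>F. \<Sum>y\<in>F. autocorrelation G g (y \<ominus> x))"
    using assms(2) by (intro sum.cong refl autocorrelation_shift) auto
  also have "\<dots> \<le> (\<Sum>x\<in>F. \<Sum>d\<in>carrier G. \<bar>autocorrelation G g d\<bar>)"
  proof (rule sum_mono)
    fix x assume x: "x \<in> F"
    have inj: "inj_on (\<lambda>y. y \<ominus> x) F"
      using assms(2) x by (auto simp: inj_on_def minus_eq subset_iff)
    have "(\<Sum>y\<in>F. autocorrelation G g (y \<ominus> x)) \<le> (\<Sum>y\<in>F. \<bar>autocorrelation G g (y \<ominus> x)\<bar>)"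
      by (intro sum_mono) simp
    also have "\<dots> = (\<Sum>d\<in>(\<lambda>y. y \<ominus> x) ` F. \<bar>autocorrelation G g d\<bar>)"
      by (simp add: sum.reindex[OF inj])
    also have "\<dots> \<le> (\<Sum>d\<in>carrier G. \<bar>autocorrelation G g d\<bar>)"
      using assms x by (intro sum_mono2) auto
    finally show "(\<Sum>y\<in>F. autocorrelation G g (y \<ominus> x)) \<le> \<dots>" .
  qed
  finally show ?thesis by simp
qed

section \<open>Second moments over all colourings\<close>

text \<open>The square expands into products of weights at \<open>h\<close>,
  \<open>h \<oplus> d\<close>, \<open>k\<close>, \<open>k \<oplus> d\<close>. If \<open>h\<close>
  differs from the other three points, the sum over colourings vanishes. As
  \<open>d \<noteq> \<zero>\<close>, only \<open>k = h\<close> and \<open>k = h \<ominus> d\<close>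
  remain, which gives the factor 2.\<close>

lemma (in abelian_group) sum_colorings_autocorrelation_square_le:
  fixes w :: "'c \<Rightarrow> real"
  assumes fin: "finite (carrier G)" and fB: "finite B" and w0: "(\<Sum>j\<in>B. w j) = 0"
    and w1: "\<And>j. \<bar>w j\<bar> \<le> 1" and d: "d \<in> carrier G" "d \<noteq> \<zero>"
  shows "(\<Sum>c\<in>carrier G \<rightarrow>\<^sub>E B. (autocorrelation G (w \<circ> c) d)\<^sup>2)
       \<le> 2 * real (order G) * real (card (carrier G \<rightarrow>\<^sub>E B))"
proof -
  let ?P = "carrier G \<rightarrow>\<^sub>E B"
  \<comment> \<open>The weight at \<open>h\<close> stands apart from the other three so that
    \<open>sum_PiE_centered_coordinate\<close> applies with \<open>u = h\<close>.\<close>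
  define T where
    "T h k = (\<Sum>c\<in>?P. w (c h) * (w (c (h \<oplus> d)) * w (c k) * w (c (k \<oplus> d))))" for h k
  have T_le: "T h k \<le> real (card ?P)" for h k
  proof -
    have "T h k \<le> (\<Sum>c\<in>?P. 1)"
      unfolding T_def
    proof (rule sum_mono)
      fix c
      have "\<bar>w (c h) * (w (c (h \<oplus> d)) * w (c k) * w (c (k \<oplus> d)))\<bar> \<le> 1"
        unfolding abs_mult by (intro mult_le_one w1) auto
      then show "w (c h) * (w (c (h \<oplus> d)) * w (c k) * w (c (k \<oplus> d))) \<le> 1" by linarith
    qed
    then show ?thesis by simp
  qed
  have T_0: "T h k = 0" if "h \<in> carrier G" "k \<in> carrier G" "k \<noteq> h" "k \<noteq> h \<ominus> d" for h k
  proof -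
    have "h \<oplus> d \<noteq> h"
      using that d by (metis add.l_cancel_one')
    moreover have "k \<oplus> d \<noteq> h"
      using that d by (auto simp: minus_eq a_assoc r_neg)
    ultimately show ?thesis
      unfolding T_def using that by (intro sum_PiE_centered_coordinate fin fB w0) auto
  qed
  have "(\<Sum>c\<in>?P. (autocorrelation G (w \<circ> c) d)\<^sup>2)
      = (\<Sum>c\<in>?P. \<Sum>h\<in>carrier G. \<Sum>k\<in>carrier G.
           w (c h) * (w (c (h \<oplus> d)) * w (c k) * w (c (k \<oplus> d))))"
    by (simp add: autocorrelation_def power2_eq_square sum_product mult_ac)
  also have "\<dots> = (\<Sum>h\<in>carrier G. \<Sum>k\<in>carrier G. T h k)"
    unfolding T_def by (subst sum.swap, rule sum.cong[OF refl], rule sum.swap)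
  also have "\<dots> \<le> (\<Sum>h\<in>carrier G. 2 * real (card ?P))"
  proof (rule sum_mono)
    fix h assume h: "h \<in> carrier G"
    have "(\<Sum>k\<in>carrier G. T h k) = (\<Sum>k\<in>{h, h \<ominus> d}. T h k)"
      using h d by (intro sum.mono_neutral_right fin) (auto simp: T_0)
    also have "\<dots> \<le> real (card {h, h \<ominus> d}) * real (card ?P)"
      by (intro sum_bounded_above T_le)
    also have "\<dots> \<le> 2 * real (card ?P)"
      by (intro mult_right_mono) (auto simp: card_insert_if)
    finally show "(\<Sum>k\<in>carrier G. T h k) \<le> 2 * real (card ?P)" .
  qed
  finally show ?thesis by (simp add: order_def mult_ac)
qed

text \<open>A function of the colour alone: composed with a colouring \<open>c\<close> it is the
  function \<open>g\<^sub>i\<close>, and its sum over the \<open>r\<close> colours is zero.\<close>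

definition centered_indicator :: "nat \<Rightarrow> nat \<Rightarrow> nat \<Rightarrow> real" where
  "centered_indicator r i j = of_bool (j = i) - 1 / real r"

lemma centered_indicator_sum:
  assumes "i \<in> {1..r}"
  shows "(\<Sum>j\<in>{1..r}. centered_indicator r i j) = 0"
  using assms by (simp add: centered_indicator_def sum_subtractf of_bool_def)

lemma centered_indicator_abs_le:
  assumes "r \<ge> 1"
  shows "\<bar>centered_indicator r i j\<bar> \<le> 1"
  using assms by (auto simp: centered_indicator_def of_bool_def abs_if field_simps)

text \<open>The right side bounds the average of the left side over all colourings, so some
  colouring satisfies it. Summing over \<open>i\<close> before averaging yields one colouring that
  is good for all \<open>i\<close> at once.\<close>

lemma (in abelian_group) exists_uncorrelated_coloring:
  assumes fin: "finite (carrier G)" and r: "r \<ge> 1"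
  obtains c where "c \<in> carrier G \<rightarrow>\<^sub>E {1..r}"
    and "(\<Sum>i\<in>{1..r}. \<Sum>d\<in>carrier G - {\<zero>}.
           (autocorrelation G (centered_indicator r i \<circ> c) d)\<^sup>2) \<le> 2 * real r * (real (order G))\<^sup>2"
proof -
  let ?P = "carrier G \<rightarrow>\<^sub>E {1..r}"
  let ?N = "real (order G)"
  define f where "f c = (\<Sum>i\<in>{1..r}. \<Sum>d\<in>carrier G - {\<zero>}.
      (autocorrelation G (centered_indicator r i \<circ> c) d)\<^sup>2)" for c
  have fP: "finite ?P" using fin by (intro finite_PiE) auto
  have "?P \<noteq> {}" using r by (auto simp: PiE_eq_empty_iff)
  have "(\<Sum>c\<in>?P. f c) = (\<Sum>i\<in>{1..r}. \<Sum>d\<in>carrier G - {\<zero>}.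
          \<Sum>c\<in>?P. (autocorrelation G (centered_indicator r i \<circ> c) d)\<^sup>2)"
    unfolding f_def by (subst sum.swap, rule sum.cong[OF refl], rule sum.swap)
  also have "\<dots> \<le> (\<Sum>i\<in>{1..r}. \<Sum>d\<in>carrier G - {\<zero>}. 2 * ?N * real (card ?P))"
    using fin r by (intro sum_mono sum_colorings_autocorrelation_square_le
        centered_indicator_sum centered_indicator_abs_le) auto
  also have "\<dots> \<le> (\<Sum>i\<in>{1..r}. ?N * (2 * ?N * real (card ?P)))"
  proof (rule sum_mono)
    have "card (carrier G - {\<zero>}) \<le> order G"
      unfolding order_def using fin by (intro card_mono) auto
    then show "(\<Sum>d\<in>carrier G - {\<zero>}. 2 * ?N * real (card ?P)) \<le> ?N * (2 * ?N * real (card ?P))"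
      unfolding sum_constant by (intro mult_right_mono) auto
  qed
  also have "\<dots> = (\<Sum>c\<in>?P. 2 * real r * ?N\<^sup>2)"
    by (simp add: power2_eq_square)
  finally have "(\<Sum>c\<in>?P. f c) \<le> (\<Sum>c\<in>?P. 2 * real r * ?N\<^sup>2)" .
  then have "\<exists>c\<in>?P. f c \<le> 2 * real r * ?N\<^sup>2"
    using sum_strict_mono[OF fP \<open>?P \<noteq> {}\<close>, of "\<lambda>_. 2 * real r * ?N\<^sup>2" f] by force
  then show ?thesis using that unfolding f_def by blast
qed

section \<open>Translates of a large colour class\<close>

lemma indexed_partition_large_class:
  assumes F: "indexed_partition A t F" and fin: "finite A" and t: "t \<ge> 1"
  obtains m where "m \<in> {1..t}" "F m \<subseteq> A" "real (card (F m)) \<ge> real (card A) / real t"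
proof -
  have un: "(\<Union>i\<in>{1..t}. F i) = A"
    using F by (simp add: indexed_partition_def)
  have "\<exists>m\<in>{1..t}. real (card (F m)) \<ge> real (card A) / real t"
  proof (rule ccontr)
    assume "\<not> ?thesis"
    then have "(\<Sum>m\<in>{1..t}. real (card (F m))) < (\<Sum>m\<in>{1..t}. real (card A) / real t)"
      using t by (intro sum_strict_mono) (auto simp: not_le)
    also have "\<dots> = real (card A)" using t by simp
    finally have "(\<Sum>m\<in>{1..t}. card (F m)) < card A"
      by (simp flip: of_nat_sum)
    moreover have "card A \<le> (\<Sum>m\<in>{1..t}. card (F m))"
      using card_UN_le[of "{1..t}" F] un by simp
    ultimately show False by simp
  qed
  then show ?thesis using that un by blast
qed

text \<open>The indicator counts the \<open>x \<in> F\<close> with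
  \<open>c (x \<oplus> h) = i\<close>, which translation by \<open>h\<close> carries injectively
  onto the intersection. The sum is thus the deviation of the intersection size from its expected
  value.\<close>

lemma (in abelian_group) sum_centered_indicator_translate:
  assumes fin: "finite (carrier G)" and F: "F \<subseteq> carrier G" and h: "h \<in> carrier G"
  shows "(\<Sum>x\<in>F. (centered_indicator r i \<circ> c) (x \<oplus> h))
       = real (card ((F +> h) \<inter> {x \<in> carrier G. c x = i})) - real (card F) / real r"
proof -
  have fF: "finite F" using fin F finite_subset by blast
  have inj: "inj_on (\<lambda>x. x \<oplus> h) F"
    using F h by (auto simp: inj_on_def subset_iff)
  have "(F +> h) \<inter> {x \<in> carrier G. c x = i} = (\<lambda>x. x \<oplus> h) ` {x \<in> F. c (x \<oplus> h) = i}"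
    using F h by (auto simp: a_r_coset_def')
  then have "card ((F +> h) \<inter> {x \<in> carrier G. c x = i}) = card {x \<in> F. c (x \<oplus> h) = i}"
    using inj by (simp add: card_image inj_on_subset)
  moreover have "{x \<in> F. c (x \<oplus> h) = i} = F \<inter> {x. c (x \<oplus> h) = i}" by auto
  ultimately show ?thesis
    using fF by (simp add: centered_indicator_def sum_subtractf sum_of_bool_eq)
qed

text \<open>A largest class has expected intersection at least \<open>order G / (r * t)\<close> with
  each \<open>E i\<close>, and the constant asks for half of that. If every translate failed, each
  \<open>h\<close> would have a deviation of at least the other half, and the sum of squared
  deviations would exceed the autocorrelation bound.\<close>

lemma has_unavoidable_partition_large_order:
  fixes G :: "'a ring" (structure)
  assumes G: "abelian_group G" and fin: "finite (carrier G)" and r: "r \<ge> 1" and t: "t \<ge> 1"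
    and large: "order G > 8 * r ^ 3 * t\<^sup>2 * (1 + 4 * r ^ 4 * t\<^sup>2)"
  shows "has_unavoidable_partition r t (1 / (2 * real r * real t)) G"
proof -
  interpret abelian_group G by (fact G)
  let ?N = "real (order G)"
  have N: "?N > 0"
    using le_less_trans[OF le0 large] by (rule of_nat_0_less_iff[THEN iffD2])
  obtain c where c: "c \<in> carrier G \<rightarrow>\<^sub>E {1..r}"
    and unc: "(\<Sum>i\<in>{1..r}. \<Sum>d\<in>carrier G - {\<zero>}.
           (autocorrelation G (centered_indicator r i \<circ> c) d)\<^sup>2) \<le> 2 * real r * ?N\<^sup>2"
    using exists_uncorrelated_coloring[OF fin r] .
  define A where "A i = autocorrelation G (centered_indicator r i \<circ> c)" for i
  \<comment> \<open>Chosen so that in the final comparison the term with \<open>\<epsilon>\<close>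
    absorbs exactly half of the cubic lower bound.\<close>
  define \<epsilon> where "\<epsilon> = 1 / (4 * real r ^ 3 * (real t)\<^sup>2)"
  have \<epsilon>: "\<epsilon> > 0" using r t by (simp add: \<epsilon>_def)
  have A_le: "\<bar>A i d\<bar> \<le> ?N" for i d
  proof -
    have "\<bar>A i d\<bar> \<le> (\<Sum>x\<in>carrier G.
        \<bar>(centered_indicator r i \<circ> c) x * (centered_indicator r i \<circ> c) (x \<oplus> d)\<bar>)"
      unfolding A_def autocorrelation_def by (rule sum_abs)
    also have "\<dots> \<le> (\<Sum>x\<in>carrier G. 1)"
      unfolding abs_mult comp_def
      by (intro sum_mono mult_le_one centered_indicator_abs_le r) auto
    finally show ?thesis by (simp add: order_def)
  qed
  have A_sum: "(\<Sum>d\<in>carrier G. \<bar>A i d\<bar>) \<le> ?N + ?N * (r / \<epsilon>) + \<epsilon> * ?N\<^sup>2 / 2"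
    if i: "i \<in> {1..r}" for i
  proof -
    have "(\<Sum>d\<in>carrier G - {\<zero>}. (A i d)\<^sup>2) \<le> (\<Sum>i\<in>{1..r}. \<Sum>d\<in>carrier G - {\<zero>}. (A i d)\<^sup>2)"
      using i by (intro member_le_sum[of i "{1..r}" "\<lambda>i. \<Sum>d\<in>carrier G - {\<zero>}. (A i d)\<^sup>2"])
        (auto intro: sum_nonneg)
    also have "\<dots> \<le> 2 * real r * ?N\<^sup>2"
      using unc by (simp add: A_def)
    finally have sq: "(\<Sum>d\<in>carrier G - {\<zero>}. (A i d)\<^sup>2) \<le> 2 * real r * ?N\<^sup>2" .
    \<comment> \<open>Weighted AM-GM passes from the bound on squares to a bound on absolute values
      without square roots.\<close>
    have amgm: "\<bar>a\<bar> \<le> a\<^sup>2 / (2 * \<epsilon> * ?N) + \<epsilon> * ?N / 2" for a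
    proof -
      have "0 \<le> (\<bar>a\<bar> - \<epsilon> * ?N)\<^sup>2 / (2 * \<epsilon> * ?N)"
        using \<epsilon> N by simp
      also have "\<dots> = a\<^sup>2 / (2 * \<epsilon> * ?N) + \<epsilon> * ?N / 2 - \<bar>a\<bar>"
        using \<epsilon> N by (simp add: power2_diff field_simps power2_eq_square)
      finally show ?thesis by simp
    qed
    \<comment> \<open>The second moment bound excludes \<open>d = \<zero>\<close>; that term gets
      the trivial bound \<open>?N\<close>.\<close>
    have "(\<Sum>d\<in>carrier G. \<bar>A i d\<bar>) = \<bar>A i \<zero>\<bar> + (\<Sum>d\<in>carrier G - {\<zero>}. \<bar>A i d\<bar>)"
      by (rule sum.remove[OF fin zero_closed])
    also have "\<dots> \<le> ?N + (\<Sum>d\<in>carrier G - {\<zero>}. (A i d)\<^sup>2 / (2 * \<epsilon> * ?N) + \<epsilon> * ?N / 2)"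
      by (intro add_mono sum_mono amgm A_le)
    also have "\<dots> = ?N + (\<Sum>d\<in>carrier G - {\<zero>}. (A i d)\<^sup>2) / (2 * \<epsilon> * ?N)
        + real (card (carrier G - {\<zero>})) * (\<epsilon> * ?N / 2)"
      by (simp add: sum.distrib sum_divide_distrib)
    also have "\<dots> \<le> ?N + (2 * real r * ?N\<^sup>2) / (2 * \<epsilon> * ?N) + ?N * (\<epsilon> * ?N / 2)"
      using \<epsilon> N sq fin
      by (intro add_mono divide_right_mono mult_right_mono) (auto simp: order_def intro: card_mono)
    also have "\<dots> = ?N + ?N * (r / \<epsilon>) + \<epsilon> * ?N\<^sup>2 / 2"
      using \<epsilon> N by (simp add: field_simps power2_eq_square)
    finally show ?thesis .
  qed
  define E where "E i = {x \<in> carrier G. c x = i}" for i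
  have "indexed_partition (carrier G) r E"
    using c by (auto simp: indexed_partition_def E_def disjoint_family_on_def PiE_iff)
  moreover have "\<exists>m\<in>{1..t}. \<exists>h\<in>carrier G. \<forall>i\<in>{1..r}.
      real (card ((F m +> h) \<inter> E i)) \<ge> 1 / (2 * real r * real t) * ?N"
    if F: "indexed_partition (carrier G) t F" for F
  proof -
    obtain m where m: "m \<in> {1..t}" and Fm: "F m \<subseteq> carrier G"
      and big: "real (card (F m)) \<ge> ?N / real t"
      using indexed_partition_large_class[OF F fin t] unfolding order_def by metis
    have cF: "real (card (F m)) \<le> ?N"
      using card_mono[OF fin Fm] by (simp add: order_def)
    define D where "D i h = (\<Sum>x\<in>F m. (centered_indicator r i \<circ> c) (x \<oplus> h))" for i h
    have "\<exists>h\<in>carrier G. \<forall>i\<in>{1..r}.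
        real (card ((F m +> h) \<inter> E i)) \<ge> 1 / (2 * real r * real t) * ?N"
    proof (rule ccontr)
      assume neg: "\<not> ?thesis"
      \<comment> \<open>The index at which a translate fails depends on \<open>h\<close>; summing
        the squares over all \<open>i\<close> removes this dependence.\<close>
      have low: "(?N / (2 * real r * real t))\<^sup>2 \<le> (\<Sum>i\<in>{1..r}. (D i h)\<^sup>2)"
        if h: "h \<in> carrier G" for h
      proof -
        obtain i where i: "i \<in> {1..r}"
          and small: "real (card ((F m +> h) \<inter> E i)) < 1 / (2 * real r * real t) * ?N"
          using neg h by force
        have "?N / real t / real r \<le> real (card (F m)) / real r"
          using big by (intro divide_right_mono) auto
        moreover have "?N / real t / real r = 2 * (?N / (2 * real r * real t))"
          by simp
        moreover have "D i h = real (card ((F m +> h) \<inter> E i)) - real (card (F m)) / real r"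
          using sum_centered_indicator_translate[OF fin Fm h] unfolding D_def E_def .
        moreover have "real (card ((F m +> h) \<inter> E i)) < ?N / (2 * real r * real t)"
          using small by simp
        ultimately have "?N / (2 * real r * real t) \<le> - D i h"
          by linarith
        then have "(?N / (2 * real r * real t))\<^sup>2 \<le> (- D i h)\<^sup>2"
          using N by (intro power_mono) auto
        also have "\<dots> \<le> (\<Sum>i\<in>{1..r}. (D i h)\<^sup>2)"
          using i member_le_sum[of i "{1..r}" "\<lambda>i. (D i h)\<^sup>2"] by simp
        finally show ?thesis .
      qed
      have "?N * (?N / (2 * real r * real t))\<^sup>2 \<le> (\<Sum>h\<in>carrier G. \<Sum>i\<in>{1..r}. (D i h)\<^sup>2)"
        using sum_mono[of "carrier G" "\<lambda>_. (?N / (2 * real r * real t))\<^sup>2", OF low]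
        by (simp add: order_def)
      also have "\<dots> = (\<Sum>i\<in>{1..r}. \<Sum>h\<in>carrier G. (D i h)\<^sup>2)"
        by (rule sum.swap)
      also have "\<dots> \<le> (\<Sum>i\<in>{1..r}. ?N * (?N + ?N * (r / \<epsilon>) + \<epsilon> * ?N\<^sup>2 / 2))"
      proof (rule sum_mono)
        fix i assume i: "i \<in> {1..r}"
        have "(\<Sum>h\<in>carrier G. (D i h)\<^sup>2) \<le> real (card (F m)) * (\<Sum>d\<in>carrier G. \<bar>A i d\<bar>)"
          unfolding D_def A_def by (rule sum_translates_square_le[OF fin Fm])
        also have "\<dots> \<le> ?N * (?N + ?N * (r / \<epsilon>) + \<epsilon> * ?N\<^sup>2 / 2)"
          by (intro mult_mono cF A_sum[OF i] sum_nonneg) auto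
        finally show "(\<Sum>h\<in>carrier G. (D i h)\<^sup>2) \<le> \<dots>" .
      qed
      finally have le: "?N * (?N / (2 * real r * real t))\<^sup>2
          \<le> real r * (?N * (?N + ?N * (r / \<epsilon>) + \<epsilon> * ?N\<^sup>2 / 2))"
        by simp
      define K where "K = real r / \<epsilon>"
      \<comment> \<open>The factor clears the denominators. The lower bound becomes
        \<open>2 * ?N ^ 3\<close> and the term with \<open>\<epsilon>\<close> becomes
        \<open>?N ^ 3\<close>; cancelling \<open>?N\<^sup>2\<close> from what remains contradicts
        \<open>large\<close>.\<close>
      have "2 * ?N ^ 3 = 8 * (real r)\<^sup>2 * (real t)\<^sup>2 * (?N * (?N / (2 * real r * real t))\<^sup>2)"
        using r t by (simp add: field_simps power2_eq_square power3_eq_cube)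
      also have "\<dots> \<le> 8 * (real r)\<^sup>2 * (real t)\<^sup>2 * (real r * (?N * (?N + ?N * K + \<epsilon> * ?N\<^sup>2 / 2)))"
        using le unfolding K_def by (intro mult_left_mono) auto
      also have "\<dots> = ?N\<^sup>2 * (8 * real r ^ 3 * (real t)\<^sup>2 * (1 + K))
          + (4 * real r ^ 3 * (real t)\<^sup>2 * \<epsilon>) * ?N ^ 3"
        by (simp add: algebra_simps power2_eq_square power3_eq_cube)
      also have "4 * real r ^ 3 * (real t)\<^sup>2 * \<epsilon> = 1"
        using r t by (simp add: \<epsilon>_def)
      finally have "?N\<^sup>2 * ?N \<le> ?N\<^sup>2 * (8 * real r ^ 3 * (real t)\<^sup>2 * (1 + real r / \<epsilon>))"
        by (simp add: K_def power2_eq_square power3_eq_cube)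
      then have "?N \<le> 8 * real r ^ 3 * (real t)\<^sup>2 * (1 + real r / \<epsilon>)"
        using N by simp
      also have "real r / \<epsilon> = 4 * real r ^ 4 * (real t)\<^sup>2"
        by (simp add: \<epsilon>_def eval_nat_numeral)
      finally have "?N \<le> real (8 * r ^ 3 * t\<^sup>2 * (1 + 4 * r ^ 4 * t\<^sup>2))"
        by (simp add: algebra_simps)
      then have "order G \<le> 8 * r ^ 3 * t\<^sup>2 * (1 + 4 * r ^ 4 * t\<^sup>2)"
        by (rule of_nat_le_iff[THEN iffD1])
      then show False
        using large by (rule leD[THEN notE])
    qed
    then show ?thesis using m by blast
  qed
  ultimately show ?thesis
    unfolding has_unavoidable_partition_def by blast
qed

section \<open>Exponents, isomorphism invariance and copies on natural numbers\<close>

text \<open>By Lagrange, \<open>order G\<close> is itself a positive annihilating multiple.\<close>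

lemma group_exponent_le_order:
  fixes G :: "'a ring" (structure)
  assumes G: "abelian_group G" and fin: "finite (carrier G)"
  shows "group_exponent G \<le> order G"
proof -
  interpret abelian_group G by (fact G)
  have "[order G] \<cdot> x = \<zero>" if "x \<in> carrier G" for x
    using add.pow_order_eq_1[OF that] by (simp add: add_pow_def order_def)
  moreover have "order G > 0"
    using fin by (auto simp: order_def card_gt_0_iff)
  ultimately show ?thesis
    unfolding group_exponent_def by (intro Least_le) auto
qed

lemma add_monoid_iso_order:
  assumes "f \<in> iso (add_monoid G) (add_monoid H)"
  shows "order H = order G"
  using assms bij_betw_same_card by (fastforce simp: iso_def order_def)

text \<open>An isomorphism commutes with multiples and is injective, so the same \<open>n\<close>
  annihilate both groups.\<close>

lemma add_monoid_iso_group_exponent: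
  fixes G :: "'a ring" and H :: "'b ring"
  assumes G: "abelian_group G" and H: "abelian_group H"
    and f: "f \<in> iso (add_monoid G) (add_monoid H)"
  shows "group_exponent H = group_exponent G"
proof -
  interpret G: abelian_group G by (fact G)
  interpret H: abelian_group H by (fact H)
  interpret f: group_hom "add_monoid G" "add_monoid H" f
    using f by unfold_locales (auto simp: iso_def)
  have inj: "inj_on f (carrier G)" and im: "f ` carrier G = carrier H"
    using f by (auto simp: iso_def bij_betw_def)
  have "[n] \<cdot>\<^bsub>H\<^esub> f x = \<zero>\<^bsub>H\<^esub> \<longleftrightarrow> [n] \<cdot>\<^bsub>G\<^esub> x = \<zero>\<^bsub>G\<^esub>" if x: "x \<in> carrier G" for n :: nat and x
  proof -
    have "[n] \<cdot>\<^bsub>H\<^esub> f x = f ([n] \<cdot>\<^bsub>G\<^esub> x)" "f \<zero>\<^bsub>G\<^esub> = \<zero>\<^bsub>H\<^esub>"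
      using f.hom_nat_pow[of x n] x f.hom_one by (simp_all add: add_pow_def)
    then show ?thesis
      using inj x G.add.nat_pow_closed[OF x, of n] G.zero_closed
      by (metis add_pow_def inj_onD)
  qed
  then show ?thesis
    unfolding group_exponent_def im[symmetric] by auto
qed

text \<open>The partition of \<open>H\<close> is pulled back along \<open>f\<close> and a colouring
  of \<open>G\<close> is pushed forward. As \<open>f\<close> maps translates to translates
  injectively, all intersection sizes agree.\<close>

lemma add_monoid_iso_has_unavoidable_partition:
  fixes G :: "'a ring" and H :: "'b ring"
  assumes G: "abelian_group G" and f: "f \<in> iso (add_monoid G) (add_monoid H)"
    and H: "has_unavoidable_partition r t c H"
  shows "has_unavoidable_partition r t c G"
proof -
  interpret abelian_group G by (fact G)
  have inj: "inj_on f (carrier G)" and im: "f ` carrier G = carrier H"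
    and hom: "\<And>x y. x \<in> carrier G \<Longrightarrow> y \<in> carrier G \<Longrightarrow> f (x \<oplus>\<^bsub>G\<^esub> y) = f x \<oplus>\<^bsub>H\<^esub> f y"
    and closed: "\<And>x. x \<in> carrier G \<Longrightarrow> f x \<in> carrier H"
    using f by (auto simp: iso_def bij_betw_def hom_def)
  obtain E where E: "indexed_partition (carrier H) r E"
    and unavoidable: "\<And>F. indexed_partition (carrier H) t F \<Longrightarrow>
         \<exists>m\<in>{1..t}. \<exists>h\<in>carrier H. \<forall>i\<in>{1..r}.
            real (card ((F m +>\<^bsub>H\<^esub> h) \<inter> E i)) \<ge> c * real (order H)"
    using H unfolding has_unavoidable_partition_def by blast
  define E' where "E' i = {x \<in> carrier G. f x \<in> E i}" for i
  have "indexed_partition (carrier G) r E'"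
    using E closed by (fastforce simp: indexed_partition_def E'_def disjoint_family_on_def)
  moreover have "\<exists>m\<in>{1..t}. \<exists>h\<in>carrier G. \<forall>i\<in>{1..r}.
      real (card ((F m +>\<^bsub>G\<^esub> h) \<inter> E' i)) \<ge> c * real (order G)"
    if F: "indexed_partition (carrier G) t F" for F
  proof -
    have F_sub: "F m \<subseteq> carrier G" if "m \<in> {1..t}" for m
      using F that by (auto simp: indexed_partition_def)
    have "indexed_partition (carrier H) t (\<lambda>m. f ` F m)"
      unfolding indexed_partition_def disjoint_family_on_def
    proof (intro conjI ballI impI)
      show "(\<Union>i\<in>{1..t}. f ` F i) = carrier H"
        using F by (simp add: indexed_partition_def flip: im image_UN)
      fix m n assume mn: "m \<in> {1..t}" "n \<in> {1..t}" "m \<noteq> n"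
      have "f ` F m \<inter> f ` F n = f ` (F m \<inter> F n)"
        using inj_on_image_Int[OF inj F_sub F_sub] mn by simp
      then show "f ` F m \<inter> f ` F n = {}"
        using F mn by (auto simp: indexed_partition_def disjoint_family_on_def)
    qed
    from unavoidable[OF this] obtain m h' where m: "m \<in> {1..t}" and h': "h' \<in> carrier H"
      and big: "\<forall>i\<in>{1..r}. real (card ((f ` F m +>\<^bsub>H\<^esub> h') \<inter> E i)) \<ge> c * real (order H)"
      by auto
    obtain h where h: "h \<in> carrier G" and fh: "h' = f h"
      using h' im by auto
    have "card ((f ` F m +>\<^bsub>H\<^esub> f h) \<inter> E i) = card ((F m +>\<^bsub>G\<^esub> h) \<inter> E' i)" if "i \<in> {1..r}" for i
    proof -
      have "f ` ((F m +>\<^bsub>G\<^esub> h) \<inter> E' i) = (f ` F m +>\<^bsub>H\<^esub> f h) \<inter> E i"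
      proof
        show "f ` ((F m +>\<^bsub>G\<^esub> h) \<inter> E' i) \<subseteq> (f ` F m +>\<^bsub>H\<^esub> f h) \<inter> E i"
          using F_sub[OF m] h by (auto simp: a_r_coset_def' E'_def hom subset_iff)
        show "(f ` F m +>\<^bsub>H\<^esub> f h) \<inter> E i \<subseteq> f ` ((F m +>\<^bsub>G\<^esub> h) \<inter> E' i)"
        proof
          fix z assume z: "z \<in> (f ` F m +>\<^bsub>H\<^esub> f h) \<inter> E i"
          then obtain x where x: "x \<in> F m" and "z = f x \<oplus>\<^bsub>H\<^esub> f h"
            by (auto simp: a_r_coset_def')
          moreover have xG: "x \<in> carrier G"
            using F_sub[OF m] x by auto
          ultimately have "z = f (x \<oplus>\<^bsub>G\<^esub> h)"
            using h by (simp add: hom)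
          moreover have "x \<oplus>\<^bsub>G\<^esub> h \<in> F m +>\<^bsub>G\<^esub> h"
            using x by (auto simp: a_r_coset_def')
          ultimately show "z \<in> f ` ((F m +>\<^bsub>G\<^esub> h) \<inter> E' i)"
            using z xG h by (auto simp: E'_def)
        qed
      qed
      moreover have "inj_on f ((F m +>\<^bsub>G\<^esub> h) \<inter> E' i)"
        using inj by (rule inj_on_subset) (auto simp: E'_def)
      ultimately show ?thesis by (metis card_image)
    qed
    then have "\<forall>i\<in>{1..r}. real (card ((F m +>\<^bsub>G\<^esub> h) \<inter> E' i)) \<ge> c * real (order G)"
      using big add_monoid_iso_order[OF f] fh by simp
    then show ?thesis
      using m h by blast
  qed
  ultimately show ?thesis
    unfolding has_unavoidable_partition_def by blast
qed

text \<open>\<open>image_ring\<close> computes through an inverse of \<open>f\<close> on the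
  carrier, so injectivity makes \<open>f\<close> additive and the group axioms carry over.\<close>

lemma (in abelian_group) abelian_group_image_ring:
  assumes inj: "inj_on f (carrier G)"
  shows "abelian_group (image_ring f G)" "f \<in> iso (add_monoid G) (add_monoid (image_ring f G))"
proof -
  have [simp]: "carrier (image_ring f G) = f ` carrier G" "\<zero>\<^bsub>image_ring f G\<^esub> = f \<zero>"
    by (rule image_ring_carrier image_ring_zero)+
  have add[simp]: "f x \<oplus>\<^bsub>image_ring f G\<^esub> f y = f (x \<oplus> y)"
    if "x \<in> carrier G" "y \<in> carrier G" for x y
    using that inj by (simp add: image_ring_def image_group_def monoid.defs)
  show "abelian_group (image_ring f G)"
  proof (rule abelian_groupI)
    fix x assume "x \<in> carrier (image_ring f G)"
    then obtain a where a: "a \<in> carrier G" "x = f a" by auto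
    then show "\<exists>y\<in>carrier (image_ring f G). y \<oplus>\<^bsub>image_ring f G\<^esub> x = \<zero>\<^bsub>image_ring f G\<^esub>"
      by (intro bexI[of _ "f (\<ominus> a)"]) (auto simp: l_neg)
  qed (auto simp: a_ac)
  show "f \<in> iso (add_monoid G) (add_monoid (image_ring f G))"
    using inj by (auto simp: iso_def hom_def bij_betw_def)
qed

lemma exists_nat_isomorphic_copy:
  fixes G :: "'a ring"
  assumes G: "abelian_group G" and fin: "finite (carrier G)"
  obtains H :: "nat ring" and f where "abelian_group H" "finite (carrier H)"
    "f \<in> iso (add_monoid G) (add_monoid H)"
proof -
  obtain f :: "'a \<Rightarrow> nat" where "inj_on f (carrier G)"
    using finite_imp_inj_to_nat_seg[OF fin] by blast
  then show ?thesis
    using that abelian_group.abelian_group_image_ring[OF G] fin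
    by (metis finite_imageI image_ring_carrier)
qed

section \<open>Choice of the constants and transfer to arbitrary element types\<close>

theorem theorem1p4:
  fixes r t :: nat
  assumes "r \<ge> 1" and "t \<ge> 1"
  shows "(\<exists>\<alpha> N0 \<alpha>'. \<alpha> > 0 \<and> \<alpha>' \<ge> \<alpha> / real t \<and>
            cyclic_assertion TYPE(nat) r t \<alpha> N0 \<and>
            abelian_assertion TYPE(nat) r t \<alpha>' N0) \<and>
         (\<forall>\<alpha> N0 \<alpha>'.
            cyclic_assertion TYPE(nat) r t \<alpha> N0 \<and>
            abelian_assertion TYPE(nat) r t \<alpha>' N0 \<longrightarrow>
            cyclic_assertion TYPE('a) r t \<alpha> N0 \<and>
            abelian_assertion TYPE('a) r t \<alpha>' N0)"
proof (intro conjI allI impI)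
  \<comment> \<open>The same value serves as \<open>\<alpha>'\<close>, because
    \<open>t \<ge> 1\<close>. The final \<open>+ 1\<close> in \<open>N0\<close> turns
    \<open>order G \<ge> N0\<close> into the strict inequality required of large groups.\<close>
  define \<alpha> where "\<alpha> = 1 / (2 * real r * real t)"
  define N0 where "N0 = 8 * r ^ 3 * t\<^sup>2 * (1 + 4 * r ^ 4 * t\<^sup>2) + 1"
  have "\<alpha> > 0" "\<alpha> \<ge> \<alpha> / real t"
    using assms by (simp_all add: \<alpha>_def divide_le_eq)
  moreover have large: "has_unavoidable_partition r t \<alpha> G"
    if "abelian_group G" "finite (carrier G)" "order G \<ge> N0" for G :: "nat ring"
    unfolding \<alpha>_def
  proof (rule has_unavoidable_partition_large_order[OF that(1,2) assms])
    show "order G > 8 * r ^ 3 * t\<^sup>2 * (1 + 4 * r ^ 4 * t\<^sup>2)"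
      using that(3) unfolding N0_def by (rule less_le_trans[OF less_add_one])
  qed
  have "cyclic_assertion TYPE(nat) r t \<alpha> N0"
    unfolding cyclic_assertion_def using large by blast
  moreover have "abelian_assertion TYPE(nat) r t \<alpha> N0"
    unfolding abelian_assertion_def using large group_exponent_le_order le_trans by blast
  ultimately show "\<exists>\<alpha> N0 \<alpha>'. \<alpha> > 0 \<and> \<alpha>' \<ge> \<alpha> / real t \<and>
      cyclic_assertion TYPE(nat) r t \<alpha> N0 \<and> abelian_assertion TYPE(nat) r t \<alpha>' N0"
    by blast
next
  \<comment> \<open>Order, cyclicity and exponent pass from \<open>G\<close> to its copy
    \<open>H\<close> on natural numbers, and the unavoidable partition of \<open>H\<close> passes
    back.\<close>
  fix \<alpha> N0 \<alpha>'
  assume nat: "cyclic_assertion TYPE(nat) r t \<alpha> N0 \<and> abelian_assertion TYPE(nat) r t \<alpha>' N0"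
  show "cyclic_assertion TYPE('a) r t \<alpha> N0"
    unfolding cyclic_assertion_def
  proof (intro allI impI, elim conjE)
    fix N and G :: "'a ring"
    assume N: "N \<ge> N0" and G: "abelian_group G" "finite (carrier G)"
      and cyc: "cyclic_group (add_monoid G)" and order: "order G = N"
    obtain H :: "nat ring" and f where H: "abelian_group H" "finite (carrier H)"
      and f: "f \<in> iso (add_monoid G) (add_monoid H)"
      using exists_nat_isomorphic_copy[OF G] .
    have "cyclic_group (add_monoid H)"
      using cyc isomorphic_group_cyclicity[OF is_isoI[OF f]] G(1) H(1)
      by (metis abelian_group.a_group)
    then have "has_unavoidable_partition r t \<alpha> H"
      using nat N H order add_monoid_iso_order[OF f] unfolding cyclic_assertion_def by blast
    then show "has_unavoidable_partition r t \<alpha> G"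
      by (rule add_monoid_iso_has_unavoidable_partition[OF G(1) f])
  qed
  show "abelian_assertion TYPE('a) r t \<alpha>' N0"
    unfolding abelian_assertion_def
  proof (intro allI impI, elim conjE)
    fix G :: "'a ring"
    assume G: "abelian_group G" "finite (carrier G)" and exponent: "group_exponent G \<ge> N0"
    obtain H :: "nat ring" and f where H: "abelian_group H" "finite (carrier H)"
      and f: "f \<in> iso (add_monoid G) (add_monoid H)"
      using exists_nat_isomorphic_copy[OF G] .
    have "has_unavoidable_partition r t \<alpha>' H"
      using nat H exponent add_monoid_iso_group_exponent[OF G(1) H(1) f]
      unfolding abelian_assertion_def by simp
    then show "has_unavoidable_partition r t \<alpha>' G"
      by (rule add_monoid_iso_has_unavoidable_partition[OF G(1) f])
  qed
qed

end
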